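(* Let $G:\mathbb{R}^d\to[0,\infty)$ satisfy the standing assumptions listed in the context and let $t>0$. For $T>0$ define $$G_T^t(x)=-T\log\left(\frac1{(2\pi Tt)^{d/2}}\int_{\mathbb{R}^d}\exp\left(-\frac{G(y)}{T}-\frac1{2Tt}\|x-y\|^2\right)dy\right).$$ Then $G_T^t(x)\to M_G^t(x)$ as $T\to0^+$ for any $x\in\mathbb{R}^d$. In addition, if $G$ is differentiable and $\nabla G$ is locally Lipschitz continuous, the convergence is uniform on compact sets.
   Context: Notation: $B_R(m)=\{x\in\mathbb{R}^d:\|x-m\|\le R\}$ and $B_R^c(m)=\mathbb{R}^d\setminus B_R(m)$. The (regular) subdifferential of $H:\mathbb{R}^d\to\mathbb{R}$ at $x$ is $\partial H(x)=\{v\in\mathbb{R}^d:\liminf_{y\to x,\,y\ne x}\frac{H(y)-H(x)-\langle v,y-x\rangle}{\|y-x\|}\ge 0\}$. For $t>0$ the Moreau envelope is $M_H^t(x)=\inf_{y\in\mathbb{R}^d}H(y)+\frac1{2t}\|x-y\|^2$ and the proximal map is $\operatorname{prox}_{tH}(x)=\operatorname{argmin}_{y\in\mathbb{R}^d}H(y)+\frac1{2t}\|x-y\|^2$. Standing assumptions (the setting $U=G$, $F\equiv0$): $\int\exp(-G(x))\,dx<\infty$, and (1) $G$ is locally bounded and weakly convex: there is $\rho_G>0$ such that $G+\frac{\rho_G}{2}\|\cdot\|^2$ is convex. (2) $G$ is convex outside a ball: there is $M>0$ such that for all $x,y\in B_M^c(0)$ and $\lambda\in[0,1]$, $G(\lambda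 x+(1-\lambda)y)\le\lambda G(x)+(1-\lambda)G(y)$. (3) For a fixed $0<t_{\max}<1/\rho_G$ and $\phi(s)=\sup\{\|p\|: p\in\partial G(\operatorname{prox}_{tG}(x)),\ \|x\|\le s,\ 0<t\le t_{\max}\}$, it holds that $\int\phi(\|x\|)^2\exp(-M_G^{t_{\max}}(x))\,dx<\infty$. *)

theory Defs
  imports "HOL-Analysis.Analysis"
begin

text \<open>Regular subdifferential. The lower limit is taken over \<open>y \<noteq> x\<close> (filter \<^term>\<open>at x\<close>)
  and in \<^typ>\<open>ereal\<close>, since it may be infinite.\<close>

definition subdifferential :: "('a::euclidean_space \<Rightarrow> real) \<Rightarrow> 'a \<Rightarrow> 'a set" where
  "subdifferential H x =
     {v. Liminf (at x) (\<lambda>y. ereal ((H y - H x - inner v (y - x)) / norm (y - x))) \<ge> 0}"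

text \<open>The infimum is that of \<^typ>\<open>real\<close>, so this is meaningful only if the objective is bounded
  below, as is the case for nonnegative \<open>H\<close> and \<open>t > 0\<close>.\<close>

definition moreau_envelope :: "real \<Rightarrow> ('a::euclidean_space \<Rightarrow> real) \<Rightarrow> 'a \<Rightarrow> real" where
  "moreau_envelope t H x = (INF y. H y + 1 / (2 * t) * (norm (x - y))\<^sup>2)"

text \<open>The full set of minimisers; under the assumptions of weak convexity it is a
  singleton for small \<open>t\<close>.\<close>

definition prox :: "real \<Rightarrow> ('a::euclidean_space \<Rightarrow> real) \<Rightarrow> 'a \<Rightarrow> 'a set" where
  "prox t H x = {y. is_arg_min (\<lambda>y. H y + 1 / (2 * t) * (norm (x - y))\<^sup>2) (\<lambda>_. True) y}"

definition locally_bounded :: "('a::euclidean_space \<Rightarrow> real) \<Rightarrow> bool" where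
  "locally_bounded H \<longleftrightarrow> (\<forall>x. \<exists>r>0. bounded (H ` ball x r))"

definition locally_lipschitz :: "('a::euclidean_space \<Rightarrow> 'a) \<Rightarrow> bool" where
  "locally_lipschitz g \<longleftrightarrow> (\<forall>x. \<exists>r>0. \<exists>L. L-lipschitz_on (ball x r) g)"

text \<open>The complement of the ball is not a convex set (so \<^const>\<open>convex_on\<close> does not apply): the
  segment between \<open>x\<close> and \<open>y\<close> may enter the ball, and the inequality is required there too.\<close>

definition convex_outside_ball :: "real \<Rightarrow> ('a::euclidean_space \<Rightarrow> real) \<Rightarrow> bool" where
  "convex_outside_ball M H \<longleftrightarrow>
     (\<forall>x\<in>- cball 0 M. \<forall>y\<in>- cball 0 M. \<forall>l\<in>{0..1}.
        H (l *\<^sub>R x + (1 - l) *\<^sub>R y) \<le> l * H x + (1 - l) * H y)"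

text \<open>The function \<open>\<phi>\<close> of the third standing assumption, \<^typ>\<open>ennreal\<close>-valued so that the supremum
  always exists.\<close>

definition prox_subgradient_sup ::
    "real \<Rightarrow> ('a::euclidean_space \<Rightarrow> real) \<Rightarrow> real \<Rightarrow> ennreal" where
  "prox_subgradient_sup tmax G s =
     Sup {ennreal (norm p) | p x t y.
            y \<in> prox t G x \<and> p \<in> subdifferential G y \<and> norm x \<le> s \<and> 0 < t \<and> t \<le> tmax}"

definition soft_envelope ::
    "real \<Rightarrow> real \<Rightarrow> ('a::euclidean_space \<Rightarrow> real) \<Rightarrow> 'a \<Rightarrow> real" where
  "soft_envelope T t G x =
     - T * ln (1 / (2 * pi * T * t) powr (real DIM('a) / 2) *
       (LINT y|lborel. exp (- G y / T - 1 / (2 * T * t) * (norm (x - y))\<^sup>2)))"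

end

theory Submission
  imports Defs "HOL-Real_Asymp.Real_Asymp"
begin

text \<open>
  Write \<open>f y = G y + norm (x - y)\<^sup>2 / (2 t)\<close> and \<open>m = INF y. f y\<close>, and let \<open>I\<close> be the integral of
  \<open>exp (- f / T)\<close>. For \<open>T \<le> 1\<close> we have \<open>f / T \<ge> (1 / T - 1) m + f \<ge> (1 / T - 1) m + G\<close>, so \<open>I\<close> is at
  most \<open>exp (- (1 / T - 1) m)\<close> times the integral of \<open>exp (- G)\<close>. Conversely \<open>f \<le> m + \<epsilon>\<close> on a small
  ball whose radius is uniform for \<open>x\<close> in a compact set, because \<open>G\<close> is continuous and near-minimisers
  of \<open>f\<close> stay in a bounded set; this bounds \<open>I\<close> from below. After applying \<open>- T ln\<close> the errors and
  the normalising factor vanish as \<open>T \<rightarrow> 0\<close>. Continuity of \<open>G\<close> comes from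
  weak convexity.
\<close>

lemma moreau_envelope_le:
  fixes G :: "'a::euclidean_space \<Rightarrow> real"
  assumes "\<And>x. 0 \<le> G x" "0 < t"
  shows "moreau_envelope t G x \<le> G y + 1 / (2 * t) * (norm (x - y))\<^sup>2"
  unfolding moreau_envelope_def
proof (rule cINF_lower)
  show "bdd_below (range (\<lambda>y. G y + 1 / (2 * t) * (norm (x - y))\<^sup>2))"
    using assms by (intro bdd_belowI2[where m=0]) simp
qed simp

lemma moreau_envelope_le_self:
  fixes G :: "'a::euclidean_space \<Rightarrow> real"
  assumes "\<And>x. 0 \<le> G x" "0 < t"
  shows "moreau_envelope t G x \<le> G x"
  using moreau_envelope_le[OF assms, where x = x and y = x] by simp

lemma moreau_envelope_approx:
  fixes G :: "'a::euclidean_space \<Rightarrow> real"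
  assumes "\<And>x. 0 \<le> G x" "0 < t" "0 < e"
  obtains y where "G y + 1 / (2 * t) * (norm (x - y))\<^sup>2 < moreau_envelope t G x + e"
proof -
  have "bdd_below (range (\<lambda>y. G y + 1 / (2 * t) * (norm (x - y))\<^sup>2))"
    using assms by (intro bdd_belowI2[where m=0]) simp
  from cINF_less_iff[OF UNIV_not_empty this, of "moreau_envelope t G x + e"] have "\<exists>y. G y + 1 / (2 * t) * (norm (x - y))\<^sup>2 < moreau_envelope t G x + e"
    using \<open>0 < e\<close> unfolding moreau_envelope_def by simp
  then show ?thesis using that by blast
qed

text \<open>Separates the Gaussian normalisation from the integral, so that estimating the soft
  envelope reduces to bounding \<open>T * ln I\<close>. Here \<open>n\<close> stands for the
  dimension.\<close>

lemma ln_normalised_Laplace: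
  fixes I T t n :: real
  assumes "0 < I" "0 < T" "0 < t"
  shows "- T * ln (1 / (2 * pi * T * t) powr (n / 2) * I) = T * (n / 2) * ln (2 * pi * T * t) - T * ln I"
proof -
  have "ln (1 / (2 * pi * T * t) powr (n / 2) * I) = ln (1 / (2 * pi * T * t) powr (n / 2)) + ln I"
    using assms by (intro ln_mult_pos) auto
  also have "ln (1 / (2 * pi * T * t) powr (n / 2)) = - (n / 2 * ln (2 * pi * T * t))"
    using assms by (simp only: ln_powr ln_div ln_one) auto
  finally show ?thesis by (simp only: distrib_left)
qed

text \<open>Splitting \<open>f / T\<close> as \<open>(1 / T - 1) * f + f\<close> spends only the
  first summand on the infimum. The second keeps \<open>exp (- G y)\<close> as an integrable
  majorant. The first weight is nonnegative because \<open>T \<le> 1\<close>.\<close>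

lemma Laplace_exponent_le:
  fixes G :: "'a::euclidean_space \<Rightarrow> real"
  assumes nonneg: "\<And>x. 0 \<le> G x" and t: "0 < t" and T: "0 < T" "T \<le> 1"
  shows "- G y / T - 1 / (2 * T * t) * (norm (x - y))\<^sup>2
    \<le> - (1 / T - 1) * moreau_envelope t G x + - G y"
proof -
  define f where "f = G y + 1 / (2 * t) * (norm (x - y))\<^sup>2"
  have "(1 / T - 1) * moreau_envelope t G x \<le> (1 / T - 1) * f"
    using moreau_envelope_le[where G = G and x = x and y = y, OF nonneg t] T unfolding f_def
    by (intro mult_left_mono) auto
  moreover have "G y \<le> f" using t by (simp add: f_def)
  moreover have "- G y / T - 1 / (2 * T * t) * (norm (x - y))\<^sup>2 = - (1 / T - 1) * f - f"
    using t T by (simp add: f_def field_simps)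
  ultimately show ?thesis by linarith
qed

lemma integrable_Laplace:
  fixes G :: "'a::euclidean_space \<Rightarrow> real"
  assumes "\<And>x. 0 \<le> G x" "continuous_on UNIV G" "integrable lborel (\<lambda>x. exp (- G x))"
    and "0 < t" "0 < T" "T \<le> 1"
  shows "integrable lborel (\<lambda>y. exp (- G y / T - 1 / (2 * T * t) * (norm (x - y))\<^sup>2))"
proof (rule Bochner_Integration.integrable_bound)
  show "integrable lborel (\<lambda>y. exp (- (1 / T - 1) * moreau_envelope t G x) * exp (- G y))"
    using assms(3) by simp
  have "continuous_on UNIV (\<lambda>y. exp (- G y / T - 1 / (2 * T * t) * (norm (x - y))\<^sup>2))"
    using assms by (intro continuous_intros) auto
  then show "(\<lambda>y. exp (- G y / T - 1 / (2 * T * t) * (norm (x - y))\<^sup>2)) \<in> borel_measurable lborel"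
    by (simp add: borel_measurable_continuous_onI)
  show "AE y in lborel. norm (exp (- G y / T - 1 / (2 * T * t) * (norm (x - y))\<^sup>2))
      \<le> norm (exp (- (1 / T - 1) * moreau_envelope t G x) * exp (- G y))"
    unfolding mult_exp_exp real_norm_def abs_exp_cancel exp_le_cancel_iff
    by (intro AE_I2 Laplace_exponent_le assms)
qed

lemma integral_exp_pos:
  fixes h :: "'a::euclidean_space \<Rightarrow> real"
  assumes "integrable lborel (\<lambda>x. exp (h x))"
  shows "0 < (LINT x|lborel. exp (h x))"
proof -
  \<comment> \<open>A zero integral would force \<open>exp (h x) = 0\<close> almost everywhere,
    which is impossible since \<open>lborel\<close> is not the null measure.\<close>
  have "0 \<noteq> (LINT x|lborel. exp (h x))"
    using integral_nonneg_eq_0_iff_AE[OF assms] ae_filter_eq_bot_iff[of "lborel :: 'a measure"]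
    by (simp add: trivial_limit_def)
  then show ?thesis
    by (simp add: order_less_le)
qed

lemma soft_envelope_lower_bound:
  fixes G :: "'a::euclidean_space \<Rightarrow> real"
  assumes nonneg: "\<And>x. 0 \<le> G x" and cont: "continuous_on UNIV G"
    and int: "integrable lborel (\<lambda>x. exp (- G x))"
    and t: "0 < t" and T: "0 < T" "T \<le> 1"
  shows "soft_envelope T t G x \<ge> moreau_envelope t G x - T * G x
    + T * (real DIM('a) / 2) * ln (2 * pi * T * t) - T * ln (LINT y|lborel. exp (- G y))"
proof -
  define I where "I = (LINT y|lborel. exp (- G y / T - 1 / (2 * T * t) * (norm (x - y))\<^sup>2))"
  define J where "J = (LINT y|lborel. exp (- G y))"
  define m where "m = moreau_envelope t G x"
  note intI = integrable_Laplace[OF nonneg cont int t T, of x]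
  have "I > 0" unfolding I_def by (rule integral_exp_pos[OF intI])
  have "J > 0" unfolding J_def by (rule integral_exp_pos[OF int])
  have "I \<le> (LINT y|lborel. exp (- (1 / T - 1) * m) * exp (- G y))"
    unfolding I_def
  proof (rule integral_mono[OF intI])
    fix y :: 'a
    show "exp (- G y / T - 1 / (2 * T * t) * (norm (x - y))\<^sup>2) \<le> exp (- (1 / T - 1) * m) * exp (- G y)"
      unfolding m_def mult_exp_exp exp_le_cancel_iff by (rule Laplace_exponent_le[OF nonneg t T])
  qed (use int in simp)
  then have "I \<le> exp (- (1 / T - 1) * m) * J" by (simp add: J_def)
  then have "ln I \<le> ln (exp (- (1 / T - 1) * m) * J)"
    using \<open>I > 0\<close> \<open>J > 0\<close> by (subst ln_le_cancel_iff) auto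
  also have "\<dots> = - (1 / T - 1) * m + ln J"
    using \<open>J > 0\<close> by (subst ln_mult) auto
  finally have "T * ln I \<le> T * (- (1 / T - 1) * m + ln J)"
    using T by (intro mult_left_mono) auto
  also have "\<dots> = T * m - m + T * ln J" using T by (simp add: field_simps)
  \<comment> \<open>Trading \<open>T * m\<close> for \<open>T * G x\<close> leaves an error that can
    be bounded uniformly wherever \<open>G\<close> is bounded.\<close>
  also have "\<dots> \<le> T * G x - m + T * ln J"
    using moreau_envelope_le_self[where G = G and x = x, OF nonneg t] T by (simp add: m_def)
  finally have "T * ln I \<le> T * G x - m + T * ln J" .
  then show ?thesis
    unfolding soft_envelope_def I_def[symmetric] J_def[symmetric] m_def[symmetric]
    using ln_normalised_Laplace[OF \<open>I > 0\<close> \<open>0 < T\<close> t, of "real DIM('a)"] by simp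
qed

text \<open>Discarding the integral outside the ball leaves an integrand of at least
  \<open>exp (- a / T)\<close> times the volume of the ball.\<close>

lemma soft_envelope_upper_bound:
  fixes G :: "'a::euclidean_space \<Rightarrow> real"
  assumes nonneg: "\<And>x. 0 \<le> G x" and cont: "continuous_on UNIV G"
    and int: "integrable lborel (\<lambda>x. exp (- G x))"
    and t: "0 < t" and T: "0 < T" "T \<le> 1" and d: "0 < d"
    and le: "\<And>y. y \<in> ball z d \<Longrightarrow> G y + 1 / (2 * t) * (norm (x - y))\<^sup>2 \<le> a"
  shows "soft_envelope T t G x
    \<le> a + T * (real DIM('a) / 2) * ln (2 * pi * T * t) - T * ln (measure lborel (ball (0::'a) d))"
proof -
  define I where "I = (LINT y|lborel. exp (- G y / T - 1 / (2 * T * t) * (norm (x - y))\<^sup>2))"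
  define V where "V = measure lborel (ball (0::'a) d)"
  note intI = integrable_Laplace[OF nonneg cont int t T, of x]
  have "I > 0" unfolding I_def by (rule integral_exp_pos[OF intI])
  have "V > 0" unfolding V_def using d by (simp add: content_ball_pos)
  \<comment> \<open>The volume does not depend on the centre, so the error term is the same for
    every \<open>x\<close> even though \<open>z\<close> varies with \<open>x\<close>.\<close>
  have V: "measure lborel (ball z d) = V"
    using d unfolding V_def by (simp add: content_ball)
  have fin: "emeasure lborel (ball z d) < \<infinity>"
    by (rule emeasure_bounded_finite) simp
  have "(LINT y|lborel. exp (- a / T) * indicator (ball z d) y) \<le> I"
    unfolding I_def
  proof (rule integral_mono[OF _ intI])
    show "integrable lborel (\<lambda>y. exp (- a / T) * indicator (ball z d) y :: real)"
      using fin by (intro integrable_mult_right integrable_real_indicator) auto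
    fix y :: 'a
    have "- a / T \<le> - G y / T - 1 / (2 * T * t) * (norm (x - y))\<^sup>2" if "y \<in> ball z d"
    proof -
      have "- a / T \<le> - (G y + 1 / (2 * t) * (norm (x - y))\<^sup>2) / T"
        using le[OF that] T by (intro divide_right_mono) auto
      also have "\<dots> = - G y / T - 1 / (2 * T * t) * (norm (x - y))\<^sup>2"
        using t T by (simp add: field_simps)
      finally show ?thesis .
    qed
    then show "exp (- a / T) * indicator (ball z d) y
        \<le> exp (- G y / T - 1 / (2 * T * t) * (norm (x - y))\<^sup>2)"
      by (simp split: split_indicator)
  qed
  then have "exp (- a / T) * V \<le> I" by (simp add: V)
  then have "ln (exp (- a / T) * V) \<le> ln I"
    using \<open>I > 0\<close> \<open>V > 0\<close> by (subst ln_le_cancel_iff) auto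
  then have "- a / T + ln V \<le> ln I"
    using \<open>V > 0\<close> by (subst (asm) ln_mult) auto
  then have "T * (- a / T + ln V) \<le> T * ln I"
    using T by (intro mult_left_mono) auto
  moreover have "T * (- a / T + ln V) = - a + T * ln V"
    using T by (simp add: right_diff_distrib)
  ultimately have "- a + T * ln V \<le> T * ln I" by simp
  then show ?thesis
    unfolding soft_envelope_def I_def[symmetric] V_def[symmetric]
    using ln_normalised_Laplace[OF \<open>I > 0\<close> \<open>0 < T\<close> t, of "real DIM('a)"] by simp
qed

text \<open>For \<open>x\<close> in \<open>K\<close>, near-minimisers lie in one fixed ball, so
  uniform continuity of the objective in both variables on a compact product gives a radius
  independent of \<open>x\<close>.\<close>

lemma moreau_envelope_uniform_near_minimisers:
  fixes G :: "'a::euclidean_space \<Rightarrow> real"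
  assumes nonneg: "\<And>x. 0 \<le> G x" and cont: "continuous_on UNIV G"
    and t: "0 < t" and K: "compact K" and e: "0 < e"
  obtains d where "0 < d"
    "\<And>x. x \<in> K \<Longrightarrow> \<exists>z. \<forall>y\<in>ball z d. G y + 1 / (2 * t) * (norm (x - y))\<^sup>2 \<le> moreau_envelope t G x + e"
proof -
  define f where "f = (\<lambda>(x, y). G y + 1 / (2 * t) * (norm (x - y))\<^sup>2)"
  have "bounded (G ` K)"
    using K cont by (intro compact_imp_bounded compact_continuous_image continuous_on_subset[OF cont]) auto
  then obtain B where B: "\<And>x. x \<in> K \<Longrightarrow> G x \<le> B"
    unfolding bounded_real by (metis abs_le_D1 imageI)
  obtain A where A: "\<And>x. x \<in> K \<Longrightarrow> norm x \<le> A"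
    using compact_imp_bounded[OF K] unfolding bounded_iff by blast
  \<comment> \<open>A near-minimiser \<open>z\<close> satisfies
    \<open>norm (x - z)\<^sup>2 / (2 * t) \<le> G x + e \<le> B + e\<close>, hence lies within
    \<open>R\<close> of \<open>x\<close>.\<close>
  define R where "R = sqrt (2 * t * (B + e))"
  \<comment> \<open>The extra 1 leaves room for a ball of radius \<open>d \<le> 1\<close> around
    \<open>z\<close>.\<close>
  define C where "C = cball (0::'a) (A + R + 1)"
  have "continuous_on UNIV (\<lambda>p::'a \<times> 'a. G (snd p))"
    by (rule continuous_on_compose2[OF cont continuous_on_snd]) auto
  then have "continuous_on UNIV f"
    unfolding f_def case_prod_beta by (intro continuous_intros) auto
  then have "uniformly_continuous_on (K \<times> C) f"
    by (rule compact_uniformly_continuous[OF continuous_on_subset])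
      (auto simp: C_def compact_Times K)
  then obtain d' where d': "d' > 0"
    "\<And>p q. p \<in> K \<times> C \<Longrightarrow> q \<in> K \<times> C \<Longrightarrow> dist q p < d' \<Longrightarrow> dist (f q) (f p) < e / 2"
    unfolding uniformly_continuous_on_def using half_gt_zero[OF e] by metis
  define d where "d = min d' 1"
  show thesis
  proof
    show "0 < d" using d' by (simp add: d_def)
    fix x assume x: "x \<in> K"
    \<comment> \<open>Half of \<open>e\<close> pays for the choice of \<open>z\<close>, the other
      half for the oscillation of \<open>f\<close> on the ball.\<close>
    obtain z where z: "f (x, z) < moreau_envelope t G x + e / 2"
      using moreau_envelope_approx[where G = G and x = x, OF nonneg t half_gt_zero[OF e]] unfolding f_def by auto
    have "1 / (2 * t) * (norm (x - z))\<^sup>2 \<le> f (x, z)" using nonneg[of z] by (simp add: f_def)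
    also have "\<dots> \<le> B + e"
      using z moreau_envelope_le_self[where G = G and x = x, OF nonneg t] B[OF x] e by linarith
    finally have "(norm (x - z))\<^sup>2 \<le> 2 * t * (B + e)" using t by (simp add: field_simps)
    then have "norm (x - z) \<le> R" unfolding R_def by (rule real_le_rsqrt)
    then have z_le: "norm z \<le> A + R"
      using A[OF x] norm_triangle_ineq4[of x "x - z"] by simp
    have "f (x, y) \<le> moreau_envelope t G x + e" if "y \<in> ball z d" for y
    proof -
      have yz: "dist y z < d'" "dist y z < 1" using that by (auto simp: d_def dist_commute)
      then have "norm y \<le> A + R + 1"
        using z_le norm_triangle_ineq2[of y z] by (simp add: dist_norm)
      then have "dist (f (x, y)) (f (x, z)) < e / 2"
        using x z_le yz by (intro d') (auto simp: C_def dist_Pair_Pair)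
      then show ?thesis using z unfolding dist_real_def by linarith
    qed
    then show "\<exists>z. \<forall>y\<in>ball z d. G y + 1 / (2 * t) * (norm (x - y))\<^sup>2 \<le> moreau_envelope t G x + e"
      unfolding f_def prod.case by blast
  qed
qed

text \<open>The errors in the upper and lower bounds depend on \<open>x\<close> only through
  \<open>B\<close> and \<open>d\<close>, which are fixed by \<open>K\<close>, and they vanish with
  \<open>T\<close>.\<close>

lemma uniform_limit_soft_envelope:
  fixes G :: "'a::euclidean_space \<Rightarrow> real"
  assumes nonneg: "\<And>x. 0 \<le> G x" and cont: "continuous_on UNIV G"
    and int: "integrable lborel (\<lambda>x. exp (- G x))"
    and t: "0 < t" and K: "compact K"
  shows "uniform_limit K (\<lambda>T x. soft_envelope T t G x) (moreau_envelope t G) (at_right 0)"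
proof (rule uniform_limitI)
  fix e :: real assume e: "0 < e"
  obtain d where d: "0 < d"
    "\<And>x. x \<in> K \<Longrightarrow> \<exists>z. \<forall>y\<in>ball z d. G y + 1 / (2 * t) * (norm (x - y))\<^sup>2 \<le> moreau_envelope t G x + e / 2"
    using moreau_envelope_uniform_near_minimisers[OF nonneg cont t K, of "e / 2"] e by auto
  have "bounded (G ` K)"
    using K cont by (intro compact_imp_bounded compact_continuous_image continuous_on_subset[OF cont]) auto
  then obtain B where B: "\<And>x. x \<in> K \<Longrightarrow> G x \<le> B"
    unfolding bounded_real by (metis abs_le_D1 imageI)
  define J where "J = (LINT y|lborel. exp (- G y))"
  define V where "V = measure lborel (ball (0::'a) d)"
  define h where "h T = T * (real DIM('a) / 2) * ln (2 * pi * T * t)" for T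
  have "0 < 2 * pi * t" using t by simp
  \<comment> \<open>This rests on \<open>T * ln (c * T)\<close> tending to 0 for a constant
    \<open>c > 0\<close>; the factor \<open>2 * pi * t\<close> is grouped to serve as
    \<open>c\<close>.\<close>
  then have h0: "((\<lambda>T. T * (real DIM('a) / 2) * ln ((2 * pi * t) * T) - T * b) \<longlongrightarrow> 0) (at_right 0)" for b
    by real_asymp
  have h: "((\<lambda>T. h T - T * b) \<longlongrightarrow> 0) (at_right 0)" for b
    using h0[of b] by (simp add: h_def mult_ac)
  have small: "eventually (\<lambda>T. \<bar>h T - T * b\<bar> < e / 2) (at_right 0)" for b
    using tendstoD[OF h[of b], of "e / 2"] e by (simp add: dist_real_def)
  have "eventually (\<lambda>T::real. T \<in> {0<..<1}) (at_right 0)"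
    by (rule eventually_at_right_real) simp
  then show "\<forall>\<^sub>F T in at_right 0. \<forall>x\<in>K. dist (soft_envelope T t G x) (moreau_envelope t G x) < e"
    \<comment> \<open>The first instance controls the upper bound, the second the lower one, where
      \<open>B\<close> absorbs \<open>G x\<close>.\<close>
    using small[of "ln V"] small[of "B + ln J"]
  proof eventually_elim
    case (elim T)
    then have T: "0 < T" "T \<le> 1" by auto
    show ?case
    proof
      fix x assume x: "x \<in> K"
      have "soft_envelope T t G x \<ge> moreau_envelope t G x - T * G x + h T - T * ln J"
        unfolding h_def J_def by (rule soft_envelope_lower_bound[OF nonneg cont int t T])
      moreover have "T * G x \<le> T * B" using B[OF x] T by simp
      moreover obtain z
        where "\<forall>y\<in>ball z d. G y + 1 / (2 * t) * (norm (x - y))\<^sup>2 \<le> moreau_envelope t G x + e / 2"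
        using d(2)[OF x] by blast
      then have "soft_envelope T t G x \<le> moreau_envelope t G x + e / 2 + h T - T * ln V"
        unfolding h_def V_def by (intro soft_envelope_upper_bound[OF nonneg cont int t T d(1)]) auto
      ultimately show "dist (soft_envelope T t G x) (moreau_envelope t G x) < e"
        using elim unfolding dist_real_def distrib_left abs_less_iff by linarith
    qed
  qed
qed

theorem proposition4p24:
  fixes G :: "'a::euclidean_space \<Rightarrow> real"
    and \<rho> M tmax t :: real
  assumes nonneg: "\<And>x. 0 \<le> G x"
    and integrable_exp: "integrable lborel (\<lambda>x. exp (- G x))"
    and loc_bounded: "locally_bounded G"
    and rho_pos: "0 < \<rho>"
    and weakly_convex: "convex_on UNIV (\<lambda>x. G x + \<rho> / 2 * (norm x)\<^sup>2)"
    and M_pos: "0 < M"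
    and convex_outside: "convex_outside_ball M G"
    and tmax: "0 < tmax" "tmax < 1 / \<rho>"
    and phi_integrable:
      "(\<integral>\<^sup>+ x. (prox_subgradient_sup tmax G (norm x))\<^sup>2 *
          ennreal (exp (- moreau_envelope tmax G x)) \<partial>lborel) < \<infinity>"
    and t_pos: "0 < t"
  shows "(\<forall>x. ((\<lambda>T. soft_envelope T t G x) \<longlongrightarrow> moreau_envelope t G x) (at_right 0)) \<and>
    (\<forall>g. (\<forall>x. GDERIV G x :> g x) \<and> locally_lipschitz g \<longrightarrow>
      (\<forall>K. compact K \<longrightarrow>
        uniform_limit K (\<lambda>T x. soft_envelope T t G x) (moreau_envelope t G) (at_right 0)))"
proof -
  \<comment> \<open>A finite convex function on a Euclidean space is continuous; subtracting the
    quadratic then recovers \<open>G\<close>.\<close>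
  have "continuous_on UNIV (\<lambda>x. G x + \<rho> / 2 * (norm x)\<^sup>2)"
    by (rule convex_on_continuous[OF open_UNIV weakly_convex])
  then have "continuous_on UNIV (\<lambda>x. (G x + \<rho> / 2 * (norm x)\<^sup>2) - \<rho> / 2 * (norm x)\<^sup>2)"
    by (rule continuous_on_diff) (intro continuous_intros)
  then have cont: "continuous_on UNIV G" by simp
  note limit = uniform_limit_soft_envelope[OF nonneg cont integrable_exp t_pos]
  \<comment> \<open>Pointwise convergence is uniform convergence on the compact set
    \<open>{x}\<close>.\<close>
  have "((\<lambda>T. soft_envelope T t G x) \<longlongrightarrow> moreau_envelope t G x) (at_right 0)" for x
    using limit[of "{x}"] by (simp add: uniform_limit_singleton)
  then show ?thesis using limit by blast
qed

end
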